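(* Let $\mathbb{K}$ be a field of characteristic $0$. The functor $\mathcal{G}:\mathbf{Triass}\to\mathbf{rAvg_1}$, $\mathcal{G}(D,\dashv,\vdash,\perp)=(D_{ass},D_\perp,q)$, is left adjoint to the functor $\mathcal{F}:\mathbf{rAvg_1}\to\mathbf{Triass}$, $\mathcal{F}(A,B,P)=(B,\dashv_P,\vdash_P,\perp_P)$. More precisely, for any triassociative algebra $(D,\dashv,\vdash,\perp)$ and any relative averaging algebra $(A,B,P)$ of weight $1$, there is a bijection $$\mathrm{Hom}_{\mathbf{Triass}}\big((D,\dashv,\vdash,\perp),(B,\dashv_P,\vdash_P,\perp_P)\big)\cong\mathrm{Hom}_{\mathbf{rAvg_1}}\big((D_{ass},D_\perp,q),(A,B,P)\big).$$
   Context: All vector spaces and linear maps are over $\mathbb{K}$. For an associative algebra $A$, an associative $A$-bimodule is an associative algebra $B$ (product $xy$) with linear maps $A\otimes B\to B$, $(a,x)\mapsto a\cdot x$ and $B\otimes A\to B$, $(x,a)\mapsto x\cdot a$ such that for all $a,b\in A$, $x,y\in B$: $(ab)\cdot x=a\cdot(b\cdot x)$, $(a\cdot x)\cdot b=a\cdot(x\cdot b)$, $(x\cdot a)\cdot b=x\cdot(ab)$, $(xy)\cdot a=x(y\cdot a)$, $(x\cdot a)y=x(a\cdot y)$, $(a\cdot x)y=a\cdot(xy)$. $\mathbf{rAvg_1}$: objects are relative averaging algebras of weight $1$, i.e. triples $(A,B,P)$ with $A$ an associative algebra, $B$ an associative $A$-bimodule and $P:B\to A$ a relative averaging operator of weight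 $1$, i.e. a linear map with $P(x)P(y)=P(P(x)\cdot y)=P(x\cdot P(y))=P(xy)$ for all $x,y\in B$; morphisms $(A,B,P)\to(A',B',P')$ are pairs $(\varphi,\psi)$ of algebra homomorphisms $\varphi:A\to A'$, $\psi:B\to B'$ with $\psi(a\cdot x)=\varphi(a)\cdot'\psi(x)$, $\psi(x\cdot a)=\psi(x)\cdot'\varphi(a)$ for $a\in A$, $x\in B$, and $\varphi\circ P=P'\circ\psi$, where $\cdot'$ denotes the left and right $A'$-actions on $B'$. $\mathbf{Triass}$: objects are triassociative algebras, i.e. vector spaces $D$ with three bilinear operations $\dashv,\vdash,\perp$ such that for all $x,y,z\in D$: $(x\dashv y)\dashv z=x\dashv(y\dashv z)=x\dashv(y\vdash z)=x\dashv(y\perp z)$; $(x\vdash y)\dashv z=x\vdash(y\dashv z)$; $(x\dashv y)\vdash z=(x\vdash y)\vdash z=(x\perp y)\vdash z=x\vdash(y\vdash z)$; $(x\perp y)\dashv z=x\perp(y\dashv z)$; $(x\dashv y)\perp z=x\perp(y\vdash z)$; $(x\vdash y)\perp z=x\vdash(y\perp z)$; $(x\perp y)\perp z=x\perp(y\perp z)$; morphisms are linear maps preserving the three operations. Functor $\mathcal{F}$: $\mathcal{F}(A,B,P)=(B,\dashv_P,\vdash_P,\perp_P)$ with $x\dashv_Py=x\cdot P(y)$, $x\vdash_Py=P(x)\cdot y$, $x\perp_Py=xy$; $\mathcal{F}(\varphi,\psi)=\psi$. Functor $\mathcal{G}$: for a triassociative algebra $(D,\dashv,\vdash,\perp)$,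 let $I$ be the ideal of $D$ generated by the set $\{x\dashv y-x\vdash y \mid x,y\in D\}$. $D_{ass}$ is the quotient space $D/I$ with the associative product $[x][y]=[x\dashv y]=[x\vdash y]$; $D_\perp$ is the vector space $D$ with the associative product $\perp$, regarded as an associative $D_{ass}$-bimodule via $[x]\cdot y=x\vdash y$ and $y\cdot[x]=y\dashv x$; $q:D_\perp\to D_{ass}$, $q(x)=[x]$, is the quotient map, taken as a relative averaging operator of weight $1$, so that $(D_{ass},D_\perp,q)$ is a relative averaging algebra of weight $1$. On a morphism $\psi:D\to D'$ of triassociative algebras, $\mathcal{G}(\psi)=(\varphi^\psi,\psi)$ with $\varphi^\psi([x])=[\psi(x)]$.
   Formalization: G need not land in rAvg_1: for D=K with ⊣=⊢=0 and ⊥ multiplication, q is not of weight 1. Proved instead: the Hom bijection for the given G, a criterion for G(D) to have weight 1, and the full adjunction when I is enlarged by all x⊣y − x⊥y. *)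

theory Defs
  imports "HOL-Algebra.QuotRing" "HOL-Algebra.Module"
begin

text \<open>
  Vector spaces over a field \<open>K\<close> are records \<open>M\<close> with \<open>module K M\<close>. That locale uses only the
  additive and scalar structure of \<open>M\<close>, so the fields \<open>mult\<close> and \<open>one\<close> are free: \<open>mult\<close> holds the
  product of an associative algebra, and \<open>one\<close> is never used, as algebras need not have a unit.
  Morphisms are functions that are \<open>undefined\<close> outside the carrier of the source, so that
  equality of morphisms is equality of functions.
\<close>

definition char_zero :: "('k, 'm) ring_scheme \<Rightarrow> bool" where
  "char_zero K \<longleftrightarrow> (\<forall>n::nat. 0 < n \<longrightarrow> [n] \<cdot>\<^bsub>K\<^esub> \<one>\<^bsub>K\<^esub> \<noteq> \<zero>\<^bsub>K\<^esub>)"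

definition linear_hom ::
    "('k, 'm) ring_scheme \<Rightarrow> ('k, 'v, 'x) module_scheme \<Rightarrow> ('k, 'w, 'y) module_scheme \<Rightarrow> ('v \<Rightarrow> 'w) set" where
  "linear_hom K V W = {f \<in> carrier V \<rightarrow>\<^sub>E carrier W.
     (\<forall>x\<in>carrier V. \<forall>y\<in>carrier V. f (x \<oplus>\<^bsub>V\<^esub> y) = f x \<oplus>\<^bsub>W\<^esub> f y) \<and>
     (\<forall>c\<in>carrier K. \<forall>x\<in>carrier V. f (c \<odot>\<^bsub>V\<^esub> x) = c \<odot>\<^bsub>W\<^esub> f x)}"

definition bilinear_map ::
    "('k, 'm) ring_scheme \<Rightarrow> ('k, 'u, 'x) module_scheme \<Rightarrow> ('k, 'v, 'y) module_scheme \<Rightarrow>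
     ('k, 'w, 'z) module_scheme \<Rightarrow> ('u \<Rightarrow> 'v \<Rightarrow> 'w) \<Rightarrow> bool" where
  "bilinear_map K U V W f \<longleftrightarrow>
     (\<forall>x\<in>carrier U. (\<lambda>y\<in>carrier V. f x y) \<in> linear_hom K V W) \<and>
     (\<forall>y\<in>carrier V. (\<lambda>x\<in>carrier U. f x y) \<in> linear_hom K U W)"

locale associative_algebra = module K A
  for K :: "('k, 'm) ring_scheme" and A :: "('k, 'a, 'x) module_scheme" (structure) +
  assumes mult_bilinear: "bilinear_map K A A A (mult A)"
    and mult_assoc: "\<lbrakk>x \<in> carrier A; y \<in> carrier A; z \<in> carrier A\<rbrakk> \<Longrightarrow> (x \<otimes> y) \<otimes> z = x \<otimes> (y \<otimes> z)"

definition algebra_hom ::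
    "('k, 'm) ring_scheme \<Rightarrow> ('k, 'v, 'x) module_scheme \<Rightarrow> ('k, 'w, 'y) module_scheme \<Rightarrow> ('v \<Rightarrow> 'w) set" where
  "algebra_hom K A B = {f \<in> linear_hom K A B.
     \<forall>x\<in>carrier A. \<forall>y\<in>carrier A. f (x \<otimes>\<^bsub>A\<^esub> y) = f x \<otimes>\<^bsub>B\<^esub> f y}"

locale associative_bimodule =
  A: associative_algebra K A + B: associative_algebra K B
  for K :: "('k, 'm) ring_scheme" and A :: "('k, 'a, 'x) module_scheme"
    and B :: "('k, 'b, 'y) module_scheme"
    and l :: "'a \<Rightarrow> 'b \<Rightarrow> 'b" and r :: "'b \<Rightarrow> 'a \<Rightarrow> 'b" +
  assumes l_bilinear: "bilinear_map K A B B l"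
    and r_bilinear: "bilinear_map K B A B r"
    and l_mult: "\<lbrakk>a \<in> carrier A; b \<in> carrier A; x \<in> carrier B\<rbrakk> \<Longrightarrow> l (a \<otimes>\<^bsub>A\<^esub> b) x = l a (l b x)"
    and l_r: "\<lbrakk>a \<in> carrier A; b \<in> carrier A; x \<in> carrier B\<rbrakk> \<Longrightarrow> r (l a x) b = l a (r x b)"
    and r_mult: "\<lbrakk>a \<in> carrier A; b \<in> carrier A; x \<in> carrier B\<rbrakk> \<Longrightarrow> r (r x a) b = r x (a \<otimes>\<^bsub>A\<^esub> b)"
    and mult_r: "\<lbrakk>a \<in> carrier A; x \<in> carrier B; y \<in> carrier B\<rbrakk> \<Longrightarrow> r (x \<otimes>\<^bsub>B\<^esub> y) a = x \<otimes>\<^bsub>B\<^esub> r y a"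
    and r_mult_l: "\<lbrakk>a \<in> carrier A; x \<in> carrier B; y \<in> carrier B\<rbrakk> \<Longrightarrow> r x a \<otimes>\<^bsub>B\<^esub> y = x \<otimes>\<^bsub>B\<^esub> l a y"
    and l_mult_l: "\<lbrakk>a \<in> carrier A; x \<in> carrier B; y \<in> carrier B\<rbrakk> \<Longrightarrow> l a x \<otimes>\<^bsub>B\<^esub> y = l a (x \<otimes>\<^bsub>B\<^esub> y)"

record ('k, 'a, 'b) ravg =
  Alg :: "('k, 'a) module"
  Bim :: "('k, 'b) module"
  lact :: "'a \<Rightarrow> 'b \<Rightarrow> 'b"
  ract :: "'b \<Rightarrow> 'a \<Rightarrow> 'b"
  avg :: "'b \<Rightarrow> 'a"

locale relative_averaging_algebra =
  associative_bimodule K "Alg X" "Bim X" "lact X" "ract X"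
  for K :: "('k, 'm) ring_scheme" and X :: "('k, 'a, 'b) ravg" +
  assumes avg_linear: "avg X \<in> linear_hom K (Bim X) (Alg X)"
    and avg_lact: "\<lbrakk>x \<in> carrier (Bim X); y \<in> carrier (Bim X)\<rbrakk> \<Longrightarrow>
      avg X x \<otimes>\<^bsub>Alg X\<^esub> avg X y = avg X (lact X (avg X x) y)"
    and avg_ract: "\<lbrakk>x \<in> carrier (Bim X); y \<in> carrier (Bim X)\<rbrakk> \<Longrightarrow>
      avg X x \<otimes>\<^bsub>Alg X\<^esub> avg X y = avg X (ract X x (avg X y))"

locale relative_averaging_algebra_1 = relative_averaging_algebra +
  assumes avg_mult: "\<lbrakk>x \<in> carrier (Bim X); y \<in> carrier (Bim X)\<rbrakk> \<Longrightarrow>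
      avg X x \<otimes>\<^bsub>Alg X\<^esub> avg X y = avg X (x \<otimes>\<^bsub>Bim X\<^esub> y)"

definition ravg_hom ::
    "('k, 'm) ring_scheme \<Rightarrow> ('k, 'a, 'b) ravg \<Rightarrow> ('k, 'c, 'd) ravg \<Rightarrow> (('a \<Rightarrow> 'c) \<times> ('b \<Rightarrow> 'd)) set" where
  "ravg_hom K X Y = {(\<phi>, \<psi>).
     \<phi> \<in> algebra_hom K (Alg X) (Alg Y) \<and> \<psi> \<in> algebra_hom K (Bim X) (Bim Y) \<and>
     (\<forall>a\<in>carrier (Alg X). \<forall>x\<in>carrier (Bim X).
        \<psi> (lact X a x) = lact Y (\<phi> a) (\<psi> x) \<and> \<psi> (ract X x a) = ract Y (\<psi> x) (\<phi> a)) \<and>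
     (\<forall>x\<in>carrier (Bim X). \<phi> (avg X x) = avg Y (\<psi> x))}"

definition ravg_id :: "('k, 'a, 'b) ravg \<Rightarrow> ('a \<Rightarrow> 'a) \<times> ('b \<Rightarrow> 'b)" where
  "ravg_id X = ((\<lambda>a\<in>carrier (Alg X). a), (\<lambda>x\<in>carrier (Bim X). x))"

definition ravg_comp ::
    "('k, 'a, 'b) ravg \<Rightarrow> ('c \<Rightarrow> 'e) \<times> ('d \<Rightarrow> 'f) \<Rightarrow> ('a \<Rightarrow> 'c) \<times> ('b \<Rightarrow> 'd) \<Rightarrow> ('a \<Rightarrow> 'e) \<times> ('b \<Rightarrow> 'f)" where
  "ravg_comp X h g =
     (compose (carrier (Alg X)) (fst h) (fst g), compose (carrier (Bim X)) (snd h) (snd g))"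

text \<open>The field \<open>mult\<close> of a triassociative algebra is not used.\<close>

record ('k, 'd) triass = "('k, 'd) module" +
  ldash :: "'d \<Rightarrow> 'd \<Rightarrow> 'd" (infixl \<open>\<stileturn>\<index>\<close> 70)
  rdash :: "'d \<Rightarrow> 'd \<Rightarrow> 'd" (infixl \<open>\<turnstile>\<index>\<close> 70)
  perp :: "'d \<Rightarrow> 'd \<Rightarrow> 'd" (infixl \<open>\<^bold>\<bottom>\<index>\<close> 70)

locale triassociative_algebra = module K D
  for K :: "('k, 'm) ring_scheme" and D :: "('k, 'd) triass" (structure) +
  assumes ldash_bilinear: "bilinear_map K D D D (ldash D)"
    and rdash_bilinear: "bilinear_map K D D D (rdash D)"
    and perp_bilinear: "bilinear_map K D D D (perp D)"
    and triass_identities: "\<lbrakk>x \<in> carrier D; y \<in> carrier D; z \<in> carrier D\<rbrakk> \<Longrightarrow>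
      (x \<stileturn> y) \<stileturn> z = x \<stileturn> (y \<stileturn> z) \<and>
      x \<stileturn> (y \<stileturn> z) = x \<stileturn> (y \<turnstile> z) \<and>
      x \<stileturn> (y \<turnstile> z) = x \<stileturn> (y \<^bold>\<bottom> z) \<and>
      (x \<turnstile> y) \<stileturn> z = x \<turnstile> (y \<stileturn> z) \<and>
      (x \<stileturn> y) \<turnstile> z = (x \<turnstile> y) \<turnstile> z \<and>
      (x \<turnstile> y) \<turnstile> z = (x \<^bold>\<bottom> y) \<turnstile> z \<and>
      (x \<^bold>\<bottom> y) \<turnstile> z = x \<turnstile> (y \<turnstile> z) \<and>
      (x \<^bold>\<bottom> y) \<stileturn> z = x \<^bold>\<bottom> (y \<stileturn> z) \<and>
      (x \<stileturn> y) \<^bold>\<bottom> z = x \<^bold>\<bottom> (y \<turnstile> z) \<and>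
      (x \<turnstile> y) \<^bold>\<bottom> z = x \<turnstile> (y \<^bold>\<bottom> z) \<and>
      (x \<^bold>\<bottom> y) \<^bold>\<bottom> z = x \<^bold>\<bottom> (y \<^bold>\<bottom> z)"

definition triass_hom ::
    "('k, 'm) ring_scheme \<Rightarrow> ('k, 'd) triass \<Rightarrow> ('k, 'e) triass \<Rightarrow> ('d \<Rightarrow> 'e) set" where
  "triass_hom K D E = {f \<in> linear_hom K D E. \<forall>x\<in>carrier D. \<forall>y\<in>carrier D.
     f (x \<stileturn>\<^bsub>D\<^esub> y) = f x \<stileturn>\<^bsub>E\<^esub> f y \<and>
     f (x \<turnstile>\<^bsub>D\<^esub> y) = f x \<turnstile>\<^bsub>E\<^esub> f y \<and>
     f (x \<^bold>\<bottom>\<^bsub>D\<^esub> y) = f x \<^bold>\<bottom>\<^bsub>E\<^esub> f y}"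

definition F_ob :: "('k, 'a, 'b) ravg \<Rightarrow> ('k, 'b) triass" where
  "F_ob X = \<lparr>carrier = carrier (Bim X), mult = mult (Bim X), one = one (Bim X),
     zero = zero (Bim X), add = add (Bim X), smult = smult (Bim X),
     ldash = (\<lambda>x y. ract X x (avg X y)),
     rdash = (\<lambda>x y. lact X (avg X x) y),
     perp = mult (Bim X)\<rparr>"

definition F_map :: "('a \<Rightarrow> 'c) \<times> ('b \<Rightarrow> 'd) \<Rightarrow> ('b \<Rightarrow> 'd)" where
  "F_map h = snd h"

definition triass_ideal :: "('k, 'm) ring_scheme \<Rightarrow> ('k, 'd) triass \<Rightarrow> 'd set \<Rightarrow> bool" where
  "triass_ideal K D I \<longleftrightarrow> submodule I K D \<and>
     (\<forall>i\<in>I. \<forall>x\<in>carrier D.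
        i \<stileturn>\<^bsub>D\<^esub> x \<in> I \<and> x \<stileturn>\<^bsub>D\<^esub> i \<in> I \<and>
        i \<turnstile>\<^bsub>D\<^esub> x \<in> I \<and> x \<turnstile>\<^bsub>D\<^esub> i \<in> I \<and>
        i \<^bold>\<bottom>\<^bsub>D\<^esub> x \<in> I \<and> x \<^bold>\<bottom>\<^bsub>D\<^esub> i \<in> I)"

definition triass_genideal :: "('k, 'm) ring_scheme \<Rightarrow> ('k, 'd) triass \<Rightarrow> 'd set \<Rightarrow> 'd set" where
  "triass_genideal K D S = \<Inter>{I. triass_ideal K D I \<and> S \<subseteq> I}"

definition ass_ideal :: "('k, 'm) ring_scheme \<Rightarrow> ('k, 'd) triass \<Rightarrow> 'd set" where
  "ass_ideal K D = triass_genideal K D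
     {x \<stileturn>\<^bsub>D\<^esub> y \<ominus>\<^bsub>D\<^esub> x \<turnstile>\<^bsub>D\<^esub> y | x y. x \<in> carrier D \<and> y \<in> carrier D}"

text \<open>
  The product on the quotient is given by \<open>\<stileturn>\<close>; it agrees with the one given by \<open>\<turnstile>\<close> as soon as
  \<open>I\<close> contains \<open>ass_ideal K D\<close>.
\<close>

definition quot_alg :: "('k, 'd) triass \<Rightarrow> 'd set \<Rightarrow> ('k, 'd set) module" where
  "quot_alg D I = \<lparr>carrier = a_rcosets\<^bsub>D\<^esub> I,
     mult = (\<lambda>U V. \<Union>x\<in>U. \<Union>y\<in>V. I +>\<^bsub>D\<^esub> (x \<stileturn>\<^bsub>D\<^esub> y)), one = undefined,
     zero = I, add = set_add D, smult = (\<lambda>c U. \<Union>x\<in>U. I +>\<^bsub>D\<^esub> (c \<odot>\<^bsub>D\<^esub> x))\<rparr>"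

definition perp_alg :: "('k, 'd) triass \<Rightarrow> ('k, 'd) module" where
  "perp_alg D = \<lparr>carrier = carrier D, mult = perp D, one = undefined,
     zero = zero D, add = add D, smult = smult D\<rparr>"

text \<open>
  For the two ideals used here the sets of which \<open>the_elem\<close> is taken are singletons: the action of
  a class does not depend on the representative.
\<close>

definition quot_ravg :: "('k, 'd) triass \<Rightarrow> 'd set \<Rightarrow> ('k, 'd set, 'd) ravg" where
  "quot_ravg D I = \<lparr>Alg = quot_alg D I, Bim = perp_alg D,
     lact = (\<lambda>U y. the_elem ((\<lambda>x. x \<turnstile>\<^bsub>D\<^esub> y) ` U)),
     ract = (\<lambda>y U. the_elem ((\<lambda>x. y \<stileturn>\<^bsub>D\<^esub> x) ` U)),
     avg = (\<lambda>x\<in>carrier D. I +>\<^bsub>D\<^esub> x)\<rparr>"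

definition quot_map ::
    "('k, 'd) triass \<Rightarrow> 'd set \<Rightarrow> ('k, 'e) triass \<Rightarrow> 'e set \<Rightarrow> ('d \<Rightarrow> 'e) \<Rightarrow> ('d set \<Rightarrow> 'e set) \<times> ('d \<Rightarrow> 'e)" where
  "quot_map D I E J \<psi> = ((\<lambda>U\<in>a_rcosets\<^bsub>D\<^esub> I. \<Union>x\<in>U. J +>\<^bsub>E\<^esub> \<psi> x), \<psi>)"

definition G_ob :: "('k, 'm) ring_scheme \<Rightarrow> ('k, 'd) triass \<Rightarrow> ('k, 'd set, 'd) ravg" where
  "G_ob K D = quot_ravg D (ass_ideal K D)"

definition G_map ::
    "('k, 'm) ring_scheme \<Rightarrow> ('k, 'd) triass \<Rightarrow> ('k, 'e) triass \<Rightarrow> ('d \<Rightarrow> 'e) \<Rightarrow>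
     ('d set \<Rightarrow> 'e set) \<times> ('d \<Rightarrow> 'e)" where
  "G_map K D E = quot_map D (ass_ideal K D) E (ass_ideal K E)"

text \<open>
  \<open>G_ob K D\<close> always satisfies \<open>q(x)q(y) = q(q(x)\<cdot>y) = q(x\<cdot>q(y))\<close>, but \<open>q(x)q(y) = q(xy)\<close> says
  that \<open>ass_ideal K D\<close> contains every \<open>x \<stileturn> y - x \<^bold>\<bottom> y\<close>, and this can fail.
\<close>

lemma G_ob_not_weight_1:
  fixes K :: "('k, 'm) ring_scheme"
  assumes "field K"
  shows "\<exists>D :: ('k, 'k) triass. triassociative_algebra K D \<and>
    \<not> relative_averaging_algebra_1 K (G_ob K D)"
proof -
  interpret K: field K by fact
  define D :: "('k, 'k) triass" where "D = \<lparr>carrier = carrier K, mult = mult K, one = one K,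
    zero = zero K, add = add K, smult = mult K, ldash = (\<lambda>x y. \<zero>\<^bsub>K\<^esub>), rdash = (\<lambda>x y. \<zero>\<^bsub>K\<^esub>),
    perp = mult K\<rparr>"
  have sel: "carrier D = carrier K" "zero D = zero K" "add D = add K" "smult D = mult K"
    "ldash D = (\<lambda>x y. \<zero>\<^bsub>K\<^esub>)" "rdash D = (\<lambda>x y. \<zero>\<^bsub>K\<^esub>)" "perp D = mult K"
    by (simp_all add: D_def)
  have minv: "\<ominus>\<^bsub>D\<^esub> x = \<ominus>\<^bsub>K\<^esub> x" for x
    by (simp add: a_inv_def m_inv_def sel)
  have ab: "abelian_group D"
    by (rule abelian_groupI) (auto simp: sel K.a_ac intro: K.l_neg bexI[of _ "\<ominus>\<^bsub>K\<^esub> _"])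
  have mod: "module K D"
    by (rule moduleI) (auto simp: sel ab K.is_cring K.l_distr K.r_distr K.m_assoc)
  have tri: "triassociative_algebra K D"
    by (intro triassociative_algebra.intro mod triassociative_algebra_axioms.intro)
      (auto simp: sel bilinear_map_def linear_hom_def K.l_distr K.r_distr K.m_assoc K.m_lcomm)
  have zero_ideal: "triass_ideal K D {\<zero>\<^bsub>K\<^esub>}"
    unfolding triass_ideal_def
    by (auto simp: sel minv intro!: module.submoduleI[OF mod])
  have "ass_ideal K D \<subseteq> {\<zero>\<^bsub>K\<^esub>}"
    unfolding ass_ideal_def triass_genideal_def using zero_ideal
    by (intro Inter_lower) (auto simp: sel a_minus_def minv)
  moreover have "\<zero>\<^bsub>K\<^esub> \<in> ass_ideal K D"
    unfolding ass_ideal_def triass_genideal_def triass_ideal_def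
    by (auto dest!: submodule.axioms(1) subgroup.one_closed simp: sel)
  ultimately have I: "ass_ideal K D = {\<zero>\<^bsub>K\<^esub>}" by auto
  have cos: "{\<zero>\<^bsub>K\<^esub>} +>\<^bsub>D\<^esub> x = {x}" if "x \<in> carrier K" for x
    using that by (simp add: a_r_coset_def r_coset_def sel)
  have "\<not> relative_averaging_algebra_1 K (G_ob K D)"
  proof
    assume "relative_averaging_algebra_1 K (G_ob K D)"
    from relative_averaging_algebra_1.avg_mult[OF this, of "\<one>\<^bsub>K\<^esub>" "\<one>\<^bsub>K\<^esub>"]
    show False
      by (simp add: G_ob_def quot_ravg_def quot_alg_def perp_alg_def I sel cos)
  qed
  with tri show ?thesis by blast
qed

text \<open>
  Adding the missing generators gives the functor that does take values in relative averaging
  algebras of weight \<open>1\<close>.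
\<close>

definition avg_ideal :: "('k, 'm) ring_scheme \<Rightarrow> ('k, 'd) triass \<Rightarrow> 'd set" where
  "avg_ideal K D = triass_genideal K D
     ({x \<stileturn>\<^bsub>D\<^esub> y \<ominus>\<^bsub>D\<^esub> x \<turnstile>\<^bsub>D\<^esub> y | x y. x \<in> carrier D \<and> y \<in> carrier D} \<union>
      {x \<stileturn>\<^bsub>D\<^esub> y \<ominus>\<^bsub>D\<^esub> x \<^bold>\<bottom>\<^bsub>D\<^esub> y | x y. x \<in> carrier D \<and> y \<in> carrier D})"

definition G1_ob :: "('k, 'm) ring_scheme \<Rightarrow> ('k, 'd) triass \<Rightarrow> ('k, 'd set, 'd) ravg" where
  "G1_ob K D = quot_ravg D (avg_ideal K D)"

definition G1_map ::
    "('k, 'm) ring_scheme \<Rightarrow> ('k, 'd) triass \<Rightarrow> ('k, 'e) triass \<Rightarrow> ('d \<Rightarrow> 'e) \<Rightarrow>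
     ('d set \<Rightarrow> 'e set) \<times> ('d \<Rightarrow> 'e)" where
  "G1_map K D E = quot_map D (avg_ideal K D) E (avg_ideal K E)"

end

theory Submission
  imports Defs
begin

text \<open>
  The elements \<open>i\<close> of a triassociative algebra \<open>D\<close> with \<open>i \<turnstile> y = 0 = y \<stileturn> i\<close> for all \<open>y\<close> form an ideal
  that contains all \<open>x \<stileturn> y - x \<turnstile> y\<close> and all \<open>x \<stileturn> y - x \<bottom> y\<close>, because the identities make
  \<open>(x * y) \<turnstile> z\<close> and \<open>z \<stileturn> (x * y)\<close> independent of the choice of the operation \<open>*\<close>. So the quotient by
  either of the two ideals acts on \<open>D\<close>. A morphism \<open>(\<phi>, \<psi>)\<close> from this quotient to \<open>(A, B, P)\<close> is
  determined by \<open>\<psi>\<close>, since \<open>\<phi>([x]) = P(\<psi>(x))\<close>. Conversely, a morphism \<open>\<psi>\<close> from \<open>D\<close> to \<open>F(A, B, P)\<close>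
  gives a well defined \<open>\<phi>\<close>, because for weight \<open>1\<close> the kernel of \<open>P\<close> is an ideal of \<open>F(A, B, P)\<close>
  containing both kinds of generators, and hence so is its preimage under \<open>\<psi>\<close>.
\<close>

section \<open>Modules, linear maps and bilinear maps\<close>

lemma module_cong:
  assumes "module K V"
    and eq: "carrier W = carrier V" "zero W = zero V" "add W = add V" "smult W = smult V"
  shows "module K W"
proof -
  interpret module K V by fact
  have "abelian_group W"
    by (rule abelian_groupI) (auto simp: eq M.a_ac intro: M.l_neg bexI[of _ "\<ominus>\<^bsub>V\<^esub> _"])
  then show ?thesis
    by (intro moduleI)
      (auto simp: eq R.is_cring smult_l_distr smult_r_distr smult_assoc1)
qed

text \<open>Inverses are definite descriptions over carrier, zero and addition, so records sharing
  these three fields subtract alike, whatever products they carry. This serves to compare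
  \<open>F_ob X\<close> with \<open>Bim X\<close>.\<close>

lemma a_minus_cong:
  assumes "carrier W = carrier V" "zero W = zero V" "add W = add V"
  shows "x \<ominus>\<^bsub>W\<^esub> y = x \<ominus>\<^bsub>V\<^esub> y"
  using assms by (simp add: a_minus_def a_inv_def m_inv_def)

lemma (in abelian_group) minus_eq_zero_iff:
  assumes "x \<in> carrier G" "y \<in> carrier G"
  shows "x \<ominus> y = \<zero> \<longleftrightarrow> x = y"
  using assms by (metis a_minus_def add.inv_closed add.inv_equality minus_minus r_neg)

lemma (in module) submodule_zero: "submodule H R M \<Longrightarrow> \<zero>\<^bsub>M\<^esub> \<in> H"
  using subgroup.one_closed[OF submodule.axioms(1)] by fastforce

lemma (in module) abelian_subgroup_submodule:
  assumes "submodule H R M"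
  shows "abelian_subgroup H M"
  using assms by (intro abelian_subgroupI3 additive_subgroup.intro submodule.axioms(1)
      M.abelian_group_axioms)

lemma linear_homD:
  assumes "f \<in> linear_hom K V W"
  shows "f \<in> extensional (carrier V)"
    and "x \<in> carrier V \<Longrightarrow> f x \<in> carrier W"
    and "\<lbrakk>x \<in> carrier V; y \<in> carrier V\<rbrakk> \<Longrightarrow> f (x \<oplus>\<^bsub>V\<^esub> y) = f x \<oplus>\<^bsub>W\<^esub> f y"
    and "\<lbrakk>c \<in> carrier K; x \<in> carrier V\<rbrakk> \<Longrightarrow> f (c \<odot>\<^bsub>V\<^esub> x) = c \<odot>\<^bsub>W\<^esub> f x"
  using assms by (auto simp: linear_hom_def PiE_def)

lemma linear_hom_group_hom:
  assumes "module K V" "module K W" "f \<in> linear_hom K V W"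
  shows "f \<zero>\<^bsub>V\<^esub> = \<zero>\<^bsub>W\<^esub>"
    and "x \<in> carrier V \<Longrightarrow> f (\<ominus>\<^bsub>V\<^esub> x) = \<ominus>\<^bsub>W\<^esub> f x"
    and "\<lbrakk>x \<in> carrier V; y \<in> carrier V\<rbrakk> \<Longrightarrow> f (x \<ominus>\<^bsub>V\<^esub> y) = f x \<ominus>\<^bsub>W\<^esub> f y"
proof -
  interpret V: module K V by fact
  interpret W: module K W by fact
  interpret abelian_group_hom V W f
    by (intro abelian_group_homI V.M.abelian_group_axioms W.M.abelian_group_axioms
        group_hom.intro group_hom_axioms.intro V.M.a_group W.M.a_group)
      (auto simp: hom_def linear_homD[OF assms(3)])
  show "f \<zero>\<^bsub>V\<^esub> = \<zero>\<^bsub>W\<^esub>" by simp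
  show "x \<in> carrier V \<Longrightarrow> f (\<ominus>\<^bsub>V\<^esub> x) = \<ominus>\<^bsub>W\<^esub> f x" by simp
  show "\<lbrakk>x \<in> carrier V; y \<in> carrier V\<rbrakk> \<Longrightarrow> f (x \<ominus>\<^bsub>V\<^esub> y) = f x \<ominus>\<^bsub>W\<^esub> f y"
    by (simp add: a_minus_def)
qed

lemma linear_hom_compose:
  assumes "f \<in> linear_hom K U V" "g \<in> linear_hom K V W" "module K U"
  shows "compose (carrier U) g f \<in> linear_hom K U W"
proof -
  interpret U: module K U by fact
  show ?thesis
    by (auto simp: linear_hom_def compose_def linear_homD[OF assms(1)] linear_homD[OF assms(2)])
qed

text \<open>\<open>bilinear_map\<close> speaks of restricted functions. Sums and scalar multiples
  stay in the carriers of \<open>U\<close> and \<open>V\<close>, so the restrictions evaluate away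
  and leave pointwise equations fit for rewriting.\<close>

lemma bilinear_map_iff:
  assumes "module K U" "module K V"
  shows "bilinear_map K U V W f \<longleftrightarrow>
     (\<forall>x\<in>carrier U. \<forall>y\<in>carrier V. f x y \<in> carrier W) \<and>
     (\<forall>x\<in>carrier U. \<forall>x'\<in>carrier U. \<forall>y\<in>carrier V. f (x \<oplus>\<^bsub>U\<^esub> x') y = f x y \<oplus>\<^bsub>W\<^esub> f x' y) \<and>
     (\<forall>x\<in>carrier U. \<forall>y\<in>carrier V. \<forall>y'\<in>carrier V. f x (y \<oplus>\<^bsub>V\<^esub> y') = f x y \<oplus>\<^bsub>W\<^esub> f x y') \<and>
     (\<forall>c\<in>carrier K. \<forall>x\<in>carrier U. \<forall>y\<in>carrier V. f (c \<odot>\<^bsub>U\<^esub> x) y = c \<odot>\<^bsub>W\<^esub> f x y) \<and>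
     (\<forall>c\<in>carrier K. \<forall>x\<in>carrier U. \<forall>y\<in>carrier V. f x (c \<odot>\<^bsub>V\<^esub> y) = c \<odot>\<^bsub>W\<^esub> f x y)"
proof -
  interpret U: module K U by fact
  interpret V: module K V by fact
  show ?thesis
    unfolding bilinear_map_def linear_hom_def by auto
qed

lemma bilinear_mapD:
  assumes "bilinear_map K U V W f" "module K U" "module K V"
  shows "\<lbrakk>x \<in> carrier U; y \<in> carrier V\<rbrakk> \<Longrightarrow> f x y \<in> carrier W"
    and "\<lbrakk>x \<in> carrier U; x' \<in> carrier U; y \<in> carrier V\<rbrakk> \<Longrightarrow> f (x \<oplus>\<^bsub>U\<^esub> x') y = f x y \<oplus>\<^bsub>W\<^esub> f x' y"
    and "\<lbrakk>x \<in> carrier U; y \<in> carrier V; y' \<in> carrier V\<rbrakk> \<Longrightarrow> f x (y \<oplus>\<^bsub>V\<^esub> y') = f x y \<oplus>\<^bsub>W\<^esub> f x y'"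
    and "\<lbrakk>c \<in> carrier K; x \<in> carrier U; y \<in> carrier V\<rbrakk> \<Longrightarrow> f (c \<odot>\<^bsub>U\<^esub> x) y = c \<odot>\<^bsub>W\<^esub> f x y"
    and "\<lbrakk>c \<in> carrier K; x \<in> carrier U; y \<in> carrier V\<rbrakk> \<Longrightarrow> f x (c \<odot>\<^bsub>V\<^esub> y) = c \<odot>\<^bsub>W\<^esub> f x y"
  using assms(1) unfolding bilinear_map_iff[OF assms(2,3)] by blast+

text \<open>With one argument fixed the map is linear in the other, so these are instances of
  \<open>linear_hom_group_hom\<close> for the two partial maps.\<close>

lemma bilinear_map_group_hom:
  assumes "bilinear_map K U V W f" "module K U" "module K V" "module K W"
  shows "y \<in> carrier V \<Longrightarrow> f \<zero>\<^bsub>U\<^esub> y = \<zero>\<^bsub>W\<^esub>"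
    and "x \<in> carrier U \<Longrightarrow> f x \<zero>\<^bsub>V\<^esub> = \<zero>\<^bsub>W\<^esub>"
    and "\<lbrakk>x \<in> carrier U; y \<in> carrier V\<rbrakk> \<Longrightarrow> f (\<ominus>\<^bsub>U\<^esub> x) y = \<ominus>\<^bsub>W\<^esub> f x y"
    and "\<lbrakk>x \<in> carrier U; y \<in> carrier V\<rbrakk> \<Longrightarrow> f x (\<ominus>\<^bsub>V\<^esub> y) = \<ominus>\<^bsub>W\<^esub> f x y"
    and "\<lbrakk>x \<in> carrier U; x' \<in> carrier U; y \<in> carrier V\<rbrakk> \<Longrightarrow> f (x \<ominus>\<^bsub>U\<^esub> x') y = f x y \<ominus>\<^bsub>W\<^esub> f x' y"
    and "\<lbrakk>x \<in> carrier U; y \<in> carrier V; y' \<in> carrier V\<rbrakk> \<Longrightarrow> f x (y \<ominus>\<^bsub>V\<^esub> y') = f x y \<ominus>\<^bsub>W\<^esub> f x y'"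
proof -
  interpret U: module K U by fact
  interpret V: module K V by fact
  have l: "(\<lambda>x\<in>carrier U. f x y) \<in> linear_hom K U W" if "y \<in> carrier V" for y
    using assms(1) that by (simp add: bilinear_map_def)
  have r: "(\<lambda>y\<in>carrier V. f x y) \<in> linear_hom K V W" if "x \<in> carrier U" for x
    using assms(1) that by (simp add: bilinear_map_def)
  note L = linear_hom_group_hom[OF assms(2,4) l] and R = linear_hom_group_hom[OF assms(3,4) r]
  show "y \<in> carrier V \<Longrightarrow> f \<zero>\<^bsub>U\<^esub> y = \<zero>\<^bsub>W\<^esub>" using L(1)[of y] by simp
  show "x \<in> carrier U \<Longrightarrow> f x \<zero>\<^bsub>V\<^esub> = \<zero>\<^bsub>W\<^esub>" using R(1)[of x] by simp
  show "\<lbrakk>x \<in> carrier U; y \<in> carrier V\<rbrakk> \<Longrightarrow> f (\<ominus>\<^bsub>U\<^esub> x) y = \<ominus>\<^bsub>W\<^esub> f x y" using L(2)[of y x] by simp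
  show "\<lbrakk>x \<in> carrier U; y \<in> carrier V\<rbrakk> \<Longrightarrow> f x (\<ominus>\<^bsub>V\<^esub> y) = \<ominus>\<^bsub>W\<^esub> f x y" using R(2)[of x y] by simp
  show "\<lbrakk>x \<in> carrier U; x' \<in> carrier U; y \<in> carrier V\<rbrakk> \<Longrightarrow> f (x \<ominus>\<^bsub>U\<^esub> x') y = f x y \<ominus>\<^bsub>W\<^esub> f x' y"
    using L(3)[of y x x'] by simp
  show "\<lbrakk>x \<in> carrier U; y \<in> carrier V; y' \<in> carrier V\<rbrakk> \<Longrightarrow> f x (y \<ominus>\<^bsub>V\<^esub> y') = f x y \<ominus>\<^bsub>W\<^esub> f x y'"
    using R(3)[of x y y'] by simp
qed


section \<open>Ideals of a triassociative algebra\<close>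

context triassociative_algebra
begin

lemmas ldash_simps [simp] = bilinear_mapD[OF ldash_bilinear module_axioms module_axioms]
  bilinear_map_group_hom[OF ldash_bilinear module_axioms module_axioms module_axioms]
lemmas rdash_simps [simp] = bilinear_mapD[OF rdash_bilinear module_axioms module_axioms]
  bilinear_map_group_hom[OF rdash_bilinear module_axioms module_axioms module_axioms]
lemmas perp_simps [simp] = bilinear_mapD[OF perp_bilinear module_axioms module_axioms]
  bilinear_map_group_hom[OF perp_bilinear module_axioms module_axioms module_axioms]

text \<open>The identities oriented as rewrite rules: brackets move to the right, and in the right
  argument of \<open>\<stileturn>\<close> each of the three operations is normalised to
  \<open>\<stileturn>\<close>.\<close>

lemma triass_assoc:
  assumes "x \<in> carrier D" "y \<in> carrier D" "z \<in> carrier D"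
  shows "(x \<stileturn> y) \<stileturn> z = x \<stileturn> (y \<stileturn> z)"
    and "x \<stileturn> (y \<turnstile> z) = x \<stileturn> (y \<stileturn> z)"
    and "x \<stileturn> (y \<^bold>\<bottom> z) = x \<stileturn> (y \<stileturn> z)"
    and "(x \<turnstile> y) \<stileturn> z = x \<turnstile> (y \<stileturn> z)"
    and "(x \<stileturn> y) \<turnstile> z = x \<turnstile> (y \<turnstile> z)"
    and "(x \<turnstile> y) \<turnstile> z = x \<turnstile> (y \<turnstile> z)"
    and "(x \<^bold>\<bottom> y) \<turnstile> z = x \<turnstile> (y \<turnstile> z)"
    and "(x \<^bold>\<bottom> y) \<stileturn> z = x \<^bold>\<bottom> (y \<stileturn> z)"
    and "(x \<stileturn> y) \<^bold>\<bottom> z = x \<^bold>\<bottom> (y \<turnstile> z)"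
    and "(x \<turnstile> y) \<^bold>\<bottom> z = x \<turnstile> (y \<^bold>\<bottom> z)"
    and "(x \<^bold>\<bottom> y) \<^bold>\<bottom> z = x \<^bold>\<bottom> (y \<^bold>\<bottom> z)"
  using triass_identities[OF assms] by simp_all

lemma triass_ideal_carrier: "triass_ideal K D (carrier D)"
  by (simp add: triass_ideal_def carrier_is_submodule)

lemma triass_genideal_ideal:
  assumes "S \<subseteq> carrier D"
  shows "triass_ideal K D (triass_genideal K D S)"
proof -
  let ?F = "{I. triass_ideal K D I \<and> S \<subseteq> I}"
  \<comment> \<open>This makes the intersected family non-empty and keeps the intersection inside
    the carrier; the intersection of an empty family would be \<open>UNIV\<close>.\<close>
  have car: "carrier D \<in> ?F" using assms triass_ideal_carrier by simp
  have sub: "submodule I K D" if "I \<in> ?F" for I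
    using that by (simp add: triass_ideal_def)
  have "submodule (\<Inter>?F) K D"
  proof (rule submoduleI)
    show "\<Inter>?F \<subseteq> carrier D" using car by blast
    show "\<zero> \<in> \<Inter>?F" using submodule_zero[OF sub] by blast
    show "\<ominus> a \<in> \<Inter>?F" if "a \<in> \<Inter>?F" for a using submoduleE(3)[OF sub] that by blast
    show "a \<oplus> b \<in> \<Inter>?F" if "a \<in> \<Inter>?F" "b \<in> \<Inter>?F" for a b
      using submoduleE(5)[OF sub] that by blast
    show "a \<odot> b \<in> \<Inter>?F" if "a \<in> carrier K" "b \<in> \<Inter>?F" for a b
      using submoduleE(4)[OF sub] that by blast
  qed
  then show ?thesis
    unfolding triass_genideal_def by (auto simp: triass_ideal_def)
qed

lemma triass_genideal_minimal:
  "\<lbrakk>triass_ideal K D J; S \<subseteq> J\<rbrakk> \<Longrightarrow> triass_genideal K D S \<subseteq> J"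
  by (auto simp: triass_genideal_def)

lemma triass_genideal_incl: "S \<subseteq> triass_genideal K D S"
  by (auto simp: triass_genideal_def)

text \<open>For each operation \<open>*\<close>, the identities turn
  \<open>(u * v) \<turnstile> y\<close> into \<open>u \<turnstile> (v \<turnstile> y)\<close> and
  \<open>y \<stileturn> (u * v)\<close> into \<open>(y \<stileturn> u) \<stileturn> v\<close>. Both
  vanish once \<open>u\<close> or \<open>v\<close> lies in the set.\<close>

lemma annihilator_ideal:
  "triass_ideal K D {i \<in> carrier D. \<forall>y\<in>carrier D. i \<turnstile> y = \<zero> \<and> y \<stileturn> i = \<zero>}" (is "triass_ideal K D ?N")
proof -
  have "submodule ?N K D"
    by (rule submoduleI) auto
  \<comment> \<open>The one case that needs associativity against the orientation of
    \<open>triass_assoc\<close>: the product equals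
    \<open>(y \<stileturn> i) \<stileturn> x\<close>, whose left factor is zero.\<close>
  moreover have "y \<stileturn> (i \<stileturn> x) = \<zero>" if "i \<in> ?N" "x \<in> carrier D" "y \<in> carrier D" for i x y
    using triass_assoc(1)[of y i x] that by simp
  ultimately show ?thesis
    by (auto simp: triass_ideal_def triass_assoc)
qed

lemma ass_ideal_ideal: "triass_ideal K D (ass_ideal K D)"
  unfolding ass_ideal_def by (rule triass_genideal_ideal) auto

lemma avg_ideal_ideal: "triass_ideal K D (avg_ideal K D)"
  unfolding avg_ideal_def by (rule triass_genideal_ideal) auto

lemma ass_ideal_minimal:
  assumes "triass_ideal K D J"
    and "\<And>x y. \<lbrakk>x \<in> carrier D; y \<in> carrier D\<rbrakk> \<Longrightarrow> x \<stileturn> y \<ominus> x \<turnstile> y \<in> J"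
  shows "ass_ideal K D \<subseteq> J"
  unfolding ass_ideal_def using assms by (intro triass_genideal_minimal) auto

lemma avg_ideal_minimal:
  assumes "triass_ideal K D J"
    and "\<And>x y. \<lbrakk>x \<in> carrier D; y \<in> carrier D\<rbrakk> \<Longrightarrow> x \<stileturn> y \<ominus> x \<turnstile> y \<in> J"
    and "\<And>x y. \<lbrakk>x \<in> carrier D; y \<in> carrier D\<rbrakk> \<Longrightarrow> x \<stileturn> y \<ominus> x \<^bold>\<bottom> y \<in> J"
  shows "avg_ideal K D \<subseteq> J"
  unfolding avg_ideal_def using assms by (intro triass_genideal_minimal) auto

lemma ass_ideal_gen: "\<lbrakk>x \<in> carrier D; y \<in> carrier D\<rbrakk> \<Longrightarrow> x \<stileturn> y \<ominus> x \<turnstile> y \<in> ass_ideal K D"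
  unfolding ass_ideal_def by (rule subsetD[OF triass_genideal_incl]) auto

lemma avg_ideal_gen:
  assumes "x \<in> carrier D" "y \<in> carrier D"
  shows "x \<stileturn> y \<ominus> x \<turnstile> y \<in> avg_ideal K D" "x \<stileturn> y \<ominus> x \<^bold>\<bottom> y \<in> avg_ideal K D"
  unfolding avg_ideal_def
  by (rule subsetD[OF triass_genideal_incl], use assms in auto)+

end

lemma triass_homD:
  assumes "f \<in> triass_hom K D E"
  shows "f \<in> linear_hom K D E"
    and "\<lbrakk>x \<in> carrier D; y \<in> carrier D\<rbrakk> \<Longrightarrow> f (x \<stileturn>\<^bsub>D\<^esub> y) = f x \<stileturn>\<^bsub>E\<^esub> f y"
    and "\<lbrakk>x \<in> carrier D; y \<in> carrier D\<rbrakk> \<Longrightarrow> f (x \<turnstile>\<^bsub>D\<^esub> y) = f x \<turnstile>\<^bsub>E\<^esub> f y"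
    and "\<lbrakk>x \<in> carrier D; y \<in> carrier D\<rbrakk> \<Longrightarrow> f (x \<^bold>\<bottom>\<^bsub>D\<^esub> y) = f x \<^bold>\<bottom>\<^bsub>E\<^esub> f y"
  using assms by (auto simp: triass_hom_def)

text \<open>Serves to bound generated ideals: once a preimage is known to be an ideal, it contains
  the whole generated ideal as soon as it contains the generators.\<close>

lemma triass_ideal_vimage:
  assumes "triassociative_algebra K D" "triassociative_algebra K E"
    and f: "f \<in> triass_hom K D E" and J: "triass_ideal K E J"
  shows "triass_ideal K D {x \<in> carrier D. f x \<in> J}" (is "triass_ideal K D ?I")
proof -
  interpret D: triassociative_algebra K D by fact
  interpret E: triassociative_algebra K E by fact
  note lin = triass_homD(1)[OF f]
  note f_simps = linear_homD[OF lin] linear_hom_group_hom[OF D.module_axioms E.module_axioms lin]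
    triass_homD(2-)[OF f]
  have sub: "submodule J K E" using J by (simp add: triass_ideal_def)
  have "submodule ?I K D"
    using E.submoduleE(3-5)[OF sub] E.submodule_zero[OF sub]
    by (intro D.submoduleI) (auto simp: f_simps)
  then show ?thesis
    using J by (auto simp: triass_ideal_def f_simps)
qed

section \<open>The quotient by an ideal that acts by zero\<close>

text \<open>Captures what the two ideals have in common, so that every construction is carried out
  once. \<open>annihilates\<close> makes the action of a class independent of its representative;
  \<open>dash_diff\<close> makes \<open>\<stileturn>\<close> and \<open>\<turnstile>\<close> agree
  on classes.\<close>

locale triass_quotient = triassociative_algebra K D
  for K :: "('k, 'm) ring_scheme" and D :: "('k, 'd) triass" (structure) +
  fixes I :: "'d set"
  assumes ideal: "triass_ideal K D I"
    and dash_diff: "\<lbrakk>x \<in> carrier D; y \<in> carrier D\<rbrakk> \<Longrightarrow> x \<stileturn> y \<ominus> x \<turnstile> y \<in> I"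
    and annihilates: "\<lbrakk>i \<in> I; y \<in> carrier D\<rbrakk> \<Longrightarrow> i \<turnstile> y = \<zero> \<and> y \<stileturn> i = \<zero>"
begin

sublocale abelian_subgroup I D
  using ideal by (intro abelian_subgroup_submodule) (simp add: triass_ideal_def)

lemma ideal_smult: "\<lbrakk>c \<in> carrier K; i \<in> I\<rbrakk> \<Longrightarrow> c \<odot> i \<in> I"
  using ideal submodule.smult_closed by (auto simp: triass_ideal_def)

lemma ideal_ldash: "\<lbrakk>i \<in> I; x \<in> carrier D\<rbrakk> \<Longrightarrow> i \<stileturn> x \<in> I"
  using ideal by (auto simp: triass_ideal_def)

lemma coset_eq_iff:
  assumes "x \<in> carrier D" "y \<in> carrier D"
  shows "I +> x = I +> y \<longleftrightarrow> x \<ominus> y \<in> I"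
proof -
  have "x \<ominus> y \<in> I \<longleftrightarrow> x \<in> I +> y"
    using a_rcos_module[OF assms(2,1)] by (simp add: a_minus_def)
  then show ?thesis
    using assms a_rcos_self a_repr_independence' a_subgroup by metis
qed

lemma coset_memD:
  assumes "x \<in> carrier D" "x' \<in> I +> x"
  shows "x' \<in> carrier D" "I +> x' = I +> x" "x' \<ominus> x \<in> I"
proof -
  show "x' \<in> carrier D" using assms by (rule a_elemrcos_carrier)
  show "I +> x' = I +> x" using a_repr_independence'[OF assms(2,1)] by simp
  then show "x' \<ominus> x \<in> I" using assms(1) \<open>x' \<in> carrier D\<close> coset_eq_iff by simp
qed

text \<open>Products, scalar multiples and induced maps on classes are defined as unions over
  representatives; this evaluates them once independence of the representative is known.\<close>

lemma UN_coset:
  assumes "x \<in> carrier D" "\<And>x'. x' \<in> I +> x \<Longrightarrow> f x' = f x"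
  shows "(\<Union>x'\<in>I +> x. f x') = f x"
proof -
  have "(\<Union>x'\<in>I +> x. f x') = (\<Union>x'\<in>I +> x. f x)"
    using assms(2) by (intro SUP_cong refl)
  then show ?thesis
    using a_rcos_self[OF assms(1)] by auto
qed

lemma the_elem_coset:
  assumes "x \<in> carrier D" "\<And>x'. x' \<in> I +> x \<Longrightarrow> f x' = f x"
  shows "the_elem (f ` (I +> x)) = f x"
proof (rule the_elem_image_unique)
  show "I +> x \<noteq> {}" using a_rcos_self[OF assms(1)] by auto
qed (fact assms(2))

lemma annihilates_diff:
  assumes "x \<in> carrier D" "x' \<in> carrier D" "x' \<ominus> x \<in> I" "y \<in> carrier D"
  shows "x' \<turnstile> y = x \<turnstile> y" "y \<stileturn> x' = y \<stileturn> x"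
  using annihilates[OF assms(3,4)] assms by (simp_all add: minus_eq_zero_iff)

abbreviation Q where "Q \<equiv> quot_alg D I"
abbreviation QR where "QR \<equiv> quot_ravg D I"

lemma carrier_quot: "carrier Q = (\<lambda>x. I +> x) ` carrier D"
  by (auto simp: quot_alg_def A_RCOSETS_def')

lemma zero_quot: "\<zero>\<^bsub>Q\<^esub> = I"
  by (simp add: quot_alg_def)

lemma add_quot: "\<lbrakk>x \<in> carrier D; y \<in> carrier D\<rbrakk> \<Longrightarrow> (I +> x) \<oplus>\<^bsub>Q\<^esub> (I +> y) = I +> (x \<oplus> y)"
  by (simp add: quot_alg_def a_rcos_sum)

lemma smult_quot:
  assumes "c \<in> carrier K" "x \<in> carrier D"
  shows "c \<odot>\<^bsub>Q\<^esub> (I +> x) = I +> (c \<odot> x)"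
proof -
  have "I +> (c \<odot> x') = I +> (c \<odot> x)" if "x' \<in> I +> x" for x'
  proof -
    note x' = coset_memD[OF assms(2) that]
    have "c \<odot> (x' \<ominus> x) \<in> I"
      using assms(1) x'(3) by (rule ideal_smult)
    then show ?thesis
      using assms x'(1)
      by (simp add: coset_eq_iff a_minus_def smult_r_distr smult_r_minus)
  qed
  then have "(\<Union>x'\<in>I +> x. I +> (c \<odot> x')) = I +> (c \<odot> x)"
    by (rule UN_coset[OF assms(2)])
  then show ?thesis
    by (simp add: quot_alg_def)
qed

text \<open>Changing the representative of the right factor leaves \<open>x \<stileturn> y\<close>
  itself unchanged, because the difference annihilates. Changing that of the left factor alters the
  product by an element of \<open>I\<close>, because \<open>I\<close> is an ideal.\<close>

lemma mult_quot:
  assumes "x \<in> carrier D" "y \<in> carrier D"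
  shows "(I +> x) \<otimes>\<^bsub>Q\<^esub> (I +> y) = I +> (x \<stileturn> y)"
proof -
  have inner: "(\<Union>y'\<in>I +> y. I +> (x' \<stileturn> y')) = I +> (x \<stileturn> y)" if "x' \<in> I +> x" for x'
  proof -
    note x' = coset_memD[OF assms(1) that]
    have "I +> (x' \<stileturn> y') = I +> (x' \<stileturn> y)" if "y' \<in> I +> y" for y'
      using annihilates_diff(2)[OF assms(2) coset_memD(1,3)[OF assms(2) that] x'(1)] by simp
    then have "(\<Union>y'\<in>I +> y. I +> (x' \<stileturn> y')) = I +> (x' \<stileturn> y)"
      using assms by (intro UN_coset)
    also have "\<dots> = I +> (x \<stileturn> y)"
      using ideal_ldash[OF x'(3) assms(2)] x' assms by (simp add: coset_eq_iff)
    finally show ?thesis .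
  qed
  have "(\<Union>x'\<in>I +> x. \<Union>y'\<in>I +> y. I +> (x' \<stileturn> y')) = (\<Union>y'\<in>I +> y. I +> (x \<stileturn> y'))"
    using inner a_rcos_self[OF assms(1)] by (intro UN_coset assms) simp
  then show ?thesis
    using inner a_rcos_self[OF assms(1)] by (simp add: quot_alg_def)
qed

lemma lact_quot: "\<lbrakk>x \<in> carrier D; y \<in> carrier D\<rbrakk> \<Longrightarrow> lact QR (I +> x) y = x \<turnstile> y"
  by (simp add: quot_ravg_def the_elem_coset annihilates_diff coset_memD(1,3))

lemma ract_quot: "\<lbrakk>x \<in> carrier D; y \<in> carrier D\<rbrakk> \<Longrightarrow> ract QR y (I +> x) = y \<stileturn> x"
  by (simp add: quot_ravg_def the_elem_coset annihilates_diff coset_memD(1,3))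

lemma avg_quot: "x \<in> carrier D \<Longrightarrow> avg QR x = I +> x"
  by (simp add: quot_ravg_def)

lemma Alg_quot: "Alg QR = Q" and Bim_quot: "Bim QR = perp_alg D"
  by (simp_all add: quot_ravg_def)

lemma perp_alg_sel: "carrier (perp_alg D) = carrier D" "mult (perp_alg D) = perp D"
  "zero (perp_alg D) = zero D" "add (perp_alg D) = add D" "smult (perp_alg D) = smult D"
  by (simp_all add: perp_alg_def)

lemmas quot_simps = carrier_quot zero_quot add_quot smult_quot mult_quot lact_quot ract_quot
  avg_quot Alg_quot Bim_quot perp_alg_sel

lemma module_quot: "module K Q"
proof -
  \<comment> \<open>The zero of the quotient is the bare set \<open>I\<close>; written as a coset it
    becomes accessible to \<open>add_quot\<close>.\<close>
  have I: "I = I +> \<zero>" using a_coset_add_zero[OF a_subset] by simp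
  have "abelian_group Q"
  proof (rule abelian_groupI)
    show "\<exists>y\<in>carrier Q. y \<oplus>\<^bsub>Q\<^esub> x = \<zero>\<^bsub>Q\<^esub>" if "x \<in> carrier Q" for x
    proof -
      from that obtain u where "u \<in> carrier D" "x = I +> u" by (auto simp: carrier_quot)
      then show ?thesis
        using I by (intro bexI[of _ "I +> \<ominus> u"]) (auto simp: quot_simps M.l_neg)
    qed
    show "\<zero>\<^bsub>Q\<^esub> \<in> carrier Q" using I by (auto simp: carrier_quot zero_quot)
    show "\<zero>\<^bsub>Q\<^esub> \<oplus>\<^bsub>Q\<^esub> x = x" if "x \<in> carrier Q" for x
      using that add_quot[OF M.zero_closed] I by (auto simp: carrier_quot zero_quot)
  qed (auto simp: quot_simps M.a_ac)
  then show ?thesis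
    by (intro moduleI)
      (auto simp: quot_simps R.is_cring smult_l_distr smult_r_distr smult_assoc1)
qed

lemma module_perp_alg: "module K (perp_alg D)"
  by (rule module_cong[OF module_axioms]) (simp_all add: perp_alg_sel)

text \<open>On representatives the multiplicative bimodule axioms become triassociative identities.
  Both \<open>q(x)q(y)\<close> and \<open>q(x\<cdot>q(y))\<close> are the class of
  \<open>x \<stileturn> y\<close>, while \<open>q(q(x)\<cdot>y)\<close> is the class of
  \<open>x \<turnstile> y\<close>, equal to it by \<open>dash_diff\<close>.\<close>

lemma relative_averaging_quot: "relative_averaging_algebra K QR"
proof -
  have "associative_algebra K Q"
    by (intro associative_algebra.intro associative_algebra_axioms.intro module_quot)
      (auto simp: bilinear_map_iff[OF module_quot module_quot] quot_simps triass_assoc)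
  moreover have "associative_algebra K (perp_alg D)"
    by (intro associative_algebra.intro associative_algebra_axioms.intro module_perp_alg)
      (auto simp: bilinear_map_iff[OF module_perp_alg module_perp_alg] quot_simps triass_assoc)
  moreover have "associative_bimodule_axioms K Q (perp_alg D) (lact QR) (ract QR)"
    by (rule associative_bimodule_axioms.intro)
      (auto simp: bilinear_map_iff[OF module_quot module_perp_alg]
        bilinear_map_iff[OF module_perp_alg module_quot] quot_simps triass_assoc)
  moreover have "avg QR \<in> extensional (carrier D)"
    by (simp add: quot_ravg_def)
  then have "relative_averaging_algebra_axioms K QR"
    by (intro relative_averaging_algebra_axioms.intro)
      (auto simp: linear_hom_def PiE_def quot_simps coset_eq_iff dash_diff)
  ultimately show ?thesis
    by (simp add: relative_averaging_algebra_def associative_bimodule_def Alg_quot Bim_quot)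
qed

lemma relative_averaging_1_quot_iff:
  "relative_averaging_algebra_1 K QR \<longleftrightarrow>
    (\<forall>x\<in>carrier D. \<forall>y\<in>carrier D. x \<stileturn> y \<ominus> x \<^bold>\<bottom> y \<in> I)"
proof -
  have "relative_averaging_algebra_1 K QR \<longleftrightarrow>
      (\<forall>x\<in>carrier D. \<forall>y\<in>carrier D. I +> (x \<stileturn> y) = I +> (x \<^bold>\<bottom> y))"
    using relative_averaging_quot
    by (simp add: relative_averaging_algebra_1_def relative_averaging_algebra_1_axioms_def
        quot_simps cong: conj_cong) (metis avg_quot mult_quot perp_simps(1))
  then show ?thesis
    by (simp add: coset_eq_iff)
qed

end

section \<open>The functor F and the kernel of the averaging operator\<close>

lemma F_ob_sel: "carrier (F_ob X) = carrier (Bim X)" "zero (F_ob X) = zero (Bim X)"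
  "add (F_ob X) = add (Bim X)" "smult (F_ob X) = smult (Bim X)"
  "ldash (F_ob X) = (\<lambda>x y. ract X x (avg X y))" "rdash (F_ob X) = (\<lambda>x y. lact X (avg X x) y)"
  "perp (F_ob X) = mult (Bim X)"
  by (simp_all add: F_ob_def)

context relative_averaging_algebra
begin

lemmas avg_simps = linear_homD(2-)[OF avg_linear]
  linear_hom_group_hom[OF B.module_axioms A.module_axioms avg_linear]
lemmas act_simps = bilinear_mapD[OF l_bilinear A.module_axioms B.module_axioms]
  bilinear_mapD[OF r_bilinear B.module_axioms A.module_axioms]
lemmas mult_simps = bilinear_mapD[OF A.mult_bilinear A.module_axioms A.module_axioms]
  bilinear_mapD[OF B.mult_bilinear B.module_axioms B.module_axioms]
lemmas zero_simps =
  bilinear_map_group_hom(1,2)[OF A.mult_bilinear A.module_axioms A.module_axioms A.module_axioms]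
  bilinear_map_group_hom(1,2)[OF l_bilinear A.module_axioms B.module_axioms B.module_axioms]
  bilinear_map_group_hom(1,2)[OF r_bilinear B.module_axioms A.module_axioms B.module_axioms]

lemma module_F_ob: "module K (F_ob X)"
  by (rule module_cong[OF B.module_axioms]) (simp_all add: F_ob_sel)

end

context relative_averaging_algebra_1
begin

text \<open>The averaging equations, read from right to left, turn \<open>avg X\<close> of a product
  under any of the three operations into the product of the values of \<open>avg X\<close>. The
  identities then reduce to associativity and the bimodule axioms.\<close>

lemma triassociative_F_ob: "triassociative_algebra K (F_ob X)"
proof (intro triassociative_algebra.intro triassociative_algebra_axioms.intro module_F_ob)
  show "bilinear_map K (F_ob X) (F_ob X) (F_ob X) (ldash (F_ob X))"
    "bilinear_map K (F_ob X) (F_ob X) (F_ob X) (rdash (F_ob X))"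
    "bilinear_map K (F_ob X) (F_ob X) (F_ob X) (perp (F_ob X))"
    unfolding bilinear_map_iff[OF module_F_ob module_F_ob]
    by (simp_all add: F_ob_sel avg_simps act_simps mult_simps)
qed (simp add: F_ob_sel avg_simps act_simps mult_simps A.mult_assoc B.mult_assoc
    avg_lact[symmetric] avg_ract[symmetric] avg_mult[symmetric] l_mult l_r r_mult mult_r
    r_mult_l l_mult_l)

text \<open>\<open>avg X\<close> carries all three operations of \<open>F_ob X\<close> to the
  product of \<open>Alg X\<close>, which vanishes as soon as one factor does.\<close>

lemma avg_kernel_ideal:
  "triass_ideal K (F_ob X) {x \<in> carrier (Bim X). avg X x = \<zero>\<^bsub>Alg X\<^esub>}" (is "triass_ideal K _ ?N")
proof -
  interpret F: triassociative_algebra K "F_ob X" by (rule triassociative_F_ob)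
  have inv: "\<ominus>\<^bsub>F_ob X\<^esub> x = \<ominus>\<^bsub>Bim X\<^esub> x" for x
    by (simp add: a_inv_def m_inv_def F_ob_sel)
  have "submodule ?N K (F_ob X)"
    by (rule F.submoduleI) (auto simp: F_ob_sel avg_simps inv)
  then show ?thesis
    by (simp add: triass_ideal_def F_ob_sel avg_simps act_simps mult_simps zero_simps
        avg_lact[symmetric] avg_ract[symmetric] avg_mult[symmetric])
qed

lemma avg_kernel_gen:
  assumes "x \<in> carrier (Bim X)" "y \<in> carrier (Bim X)"
  shows "x \<stileturn>\<^bsub>F_ob X\<^esub> y \<ominus>\<^bsub>F_ob X\<^esub> x \<turnstile>\<^bsub>F_ob X\<^esub> y \<in> {x \<in> carrier (Bim X). avg X x = \<zero>\<^bsub>Alg X\<^esub>}"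
    and "x \<stileturn>\<^bsub>F_ob X\<^esub> y \<ominus>\<^bsub>F_ob X\<^esub> x \<^bold>\<bottom>\<^bsub>F_ob X\<^esub> y \<in> {x \<in> carrier (Bim X). avg X x = \<zero>\<^bsub>Alg X\<^esub>}"
  using assms unfolding a_minus_cong[OF F_ob_sel(1-3)]
  by (simp_all add: F_ob_sel avg_simps act_simps mult_simps avg_lact[symmetric]
      avg_ract[symmetric] avg_mult[symmetric] A.M.minus_eq_zero_iff B.M.minus_closed)

text \<open>The preimage of the kernel under \<open>\<psi>\<close> is an ideal containing all
  generators. The larger ideal is treated, so that the smaller one follows by inclusion.\<close>

lemma avg_vanishes:
  assumes "triassociative_algebra K D" "\<psi> \<in> triass_hom K D (F_ob X)" "x \<in> avg_ideal K D"
  shows "avg X (\<psi> x) = \<zero>\<^bsub>Alg X\<^esub>"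
proof -
  interpret D: triassociative_algebra K D by fact
  note lin = triass_homD(1)[OF assms(2)]
  have closed: "\<psi> x \<in> carrier (Bim X)" if "x \<in> carrier D" for x
    using linear_homD(2)[OF lin that] by (simp add: F_ob_sel)
  have "avg_ideal K D \<subseteq> {x \<in> carrier D. \<psi> x \<in> {x \<in> carrier (Bim X). avg X x = \<zero>\<^bsub>Alg X\<^esub>}}"
  proof (rule D.avg_ideal_minimal)
    show "triass_ideal K D {x \<in> carrier D. \<psi> x \<in> {x \<in> carrier (Bim X). avg X x = \<zero>\<^bsub>Alg X\<^esub>}}"
      by (rule triass_ideal_vimage[OF assms(1) triassociative_F_ob assms(2) avg_kernel_ideal])
  qed (simp_all add: closed linear_hom_group_hom(3)[OF D.module_axioms module_F_ob lin]
      triass_homD(2-)[OF assms(2)] avg_kernel_gen[unfolded mem_Collect_eq]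
     )
  with assms(3) show ?thesis by blast
qed

end

text \<open>Compatibility with the actions produces factors \<open>\<phi>(P(x))\<close>, and these
  equal \<open>P'(\<psi>(x))\<close> because the pair intertwines the averaging operators.\<close>

lemma F_map_hom:
  assumes "h \<in> ravg_hom K X X'" "relative_averaging_algebra K X"
  shows "F_map h \<in> triass_hom K (F_ob X) (F_ob X')"
proof -
  interpret relative_averaging_algebra K X by fact
  show ?thesis
    using assms(1)
    by (auto simp: ravg_hom_def triass_hom_def algebra_hom_def linear_hom_def F_map_def F_ob_sel
        avg_simps)
qed

section \<open>Morphisms out of the quotient\<close>

context triass_quotient
begin

text \<open>Every class is \<open>q(x)\<close>, so intertwining the operators fixes \<open>f\<close>
  on classes, and compatibility with the actions then says that \<open>\<psi>\<close> preserves the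
  two dashes. \<open>Y\<close> is any relative averaging algebra so that
  \<open>quot_ravg E J\<close>, which can fail weight 1, may also be the target.\<close>

lemma ravg_hom_quot_iff:
  assumes "relative_averaging_algebra K Y"
  shows "(f, \<psi>) \<in> ravg_hom K QR Y \<longleftrightarrow> \<psi> \<in> triass_hom K D (F_ob Y) \<and>
    f \<in> extensional (carrier Q) \<and> (\<forall>x\<in>carrier D. f (I +> x) = avg Y (\<psi> x))" (is "?L \<longleftrightarrow> ?R")
proof
  assume L: ?L
  then have f: "f \<in> extensional (carrier Q)" "\<forall>x\<in>carrier D. f (I +> x) = avg Y (\<psi> x)"
    by (auto simp: ravg_hom_def algebra_hom_def linear_hom_def quot_simps PiE_def)
  \<comment> \<open>The dashes of \<open>D\<close> are the actions of classes, and \<open>f\<close>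
    sends the class of \<open>x\<close> to \<open>avg Y (\<psi> x)\<close>.\<close>
  have act: "\<psi> (x \<turnstile> y) = lact Y (avg Y (\<psi> x)) (\<psi> y) \<and> \<psi> (y \<stileturn> x) = ract Y (\<psi> y) (avg Y (\<psi> x))"
    if "x \<in> carrier D" "y \<in> carrier D" for x y
  proof -
    have "\<psi> (lact QR (I +> x) y) = lact Y (f (I +> x)) (\<psi> y)"
      "\<psi> (ract QR y (I +> x)) = ract Y (\<psi> y) (f (I +> x))"
      using L that by (auto simp: ravg_hom_def quot_simps)
    then show ?thesis using f that by (simp add: quot_simps)
  qed
  have "\<psi> \<in> triass_hom K D (F_ob Y)"
    using L by (auto simp: triass_hom_def F_ob_sel act)
      (auto simp: ravg_hom_def algebra_hom_def linear_hom_def quot_simps F_ob_sel)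
  with f show ?R by blast
next
  interpret Y: relative_averaging_algebra K Y by fact
  assume R: ?R
  then have f: "f \<in> extensional (carrier Q)" "\<And>x. x \<in> carrier D \<Longrightarrow> f (I +> x) = avg Y (\<psi> x)"
    and \<psi>: "\<psi> \<in> triass_hom K D (F_ob Y)" by blast+
  note \<psi>_simps = linear_homD(2-)[OF triass_homD(1)[OF \<psi>], unfolded F_ob_sel]
    triass_homD(2-)[OF \<psi>, unfolded F_ob_sel]
  have "\<psi> \<in> algebra_hom K (perp_alg D) (Bim Y)"
    using linear_homD(1)[OF triass_homD(1)[OF \<psi>]]
    by (auto simp: algebra_hom_def linear_hom_def PiE_def quot_simps \<psi>_simps)
  \<comment> \<open>Multiplicativity is \<open>avg_ract\<close> in \<open>Y\<close>: the class of
    \<open>x \<stileturn> y\<close> goes to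
    \<open>P(\<psi>(x)\<cdot>P(\<psi>(y))) = P(\<psi>(x))P(\<psi>(y))\<close>.\<close>
  moreover have "f \<in> algebra_hom K Q (Alg Y)"
    using f(1)
    by (auto simp: algebra_hom_def linear_hom_def PiE_def quot_simps f(2) \<psi>_simps
        Y.avg_simps Y.act_simps Y.avg_ract)
  ultimately show ?L
    by (auto simp: ravg_hom_def quot_simps f(2) \<psi>_simps)
qed

text \<open>The universal property of the quotient space: a linear map that kills \<open>I\<close>
  is constant on each coset, so \<open>the_elem\<close> reads off its value there.\<close>

lemma coset_lift:
  assumes "module K W" "g \<in> linear_hom K D W" "\<And>i. i \<in> I \<Longrightarrow> g i = \<zero>\<^bsub>W\<^esub>" "x \<in> carrier D"
  shows "the_elem (g ` (I +> x)) = g x"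
proof (rule the_elem_coset[OF assms(4)])
  interpret W: module K W by fact
  fix x' assume "x' \<in> I +> x"
  note x' = coset_memD[OF assms(4) this]
  have "g x' \<ominus>\<^bsub>W\<^esub> g x = \<zero>\<^bsub>W\<^esub>"
    using assms(3)[OF x'(3)] linear_hom_group_hom(3)[OF module_axioms assms(1,2) x'(1) assms(4)]
    by simp
  then show "g x' = g x"
    using linear_homD(2)[OF assms(2)] x'(1) assms(4) by (simp add: W.M.minus_eq_zero_iff)
qed

lemma bij_betw_ravg_hom_triass_hom:
  assumes Y: "relative_averaging_algebra K Y"
    and vanish: "\<And>\<psi> i. \<lbrakk>\<psi> \<in> triass_hom K D (F_ob Y); i \<in> I\<rbrakk> \<Longrightarrow> avg Y (\<psi> i) = \<zero>\<^bsub>Alg Y\<^esub>"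
  shows "bij_betw snd (ravg_hom K QR Y) (triass_hom K D (F_ob Y))"
proof (rule bij_betw_imageI)
  interpret Y: relative_averaging_algebra K Y by fact
  show "inj_on snd (ravg_hom K QR Y)"
  proof (rule inj_onI, clarsimp)
    fix f g \<psi> assume "(f, \<psi>) \<in> ravg_hom K QR Y" "(g, \<psi>) \<in> ravg_hom K QR Y"
    then show "f = g"
      by (intro extensionalityI[of f "carrier Q"]) (auto simp: ravg_hom_quot_iff[OF Y] carrier_quot)
  qed
  have "\<psi> \<in> snd ` ravg_hom K QR Y" if \<psi>: "\<psi> \<in> triass_hom K D (F_ob Y)" for \<psi>
  proof -
    \<comment> \<open>The only candidate for the first component is induced by \<open>P\<close>
      after \<open>\<psi>\<close>; \<open>vanish\<close> says that this composite kills
      \<open>I\<close>, so it descends to classes.\<close>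
    let ?g = "compose (carrier D) (avg Y) \<psi>"
    have "avg Y \<in> linear_hom K (F_ob Y) (Alg Y)"
      using Y.avg_linear by (simp add: linear_hom_def F_ob_sel)
    then have g: "?g \<in> linear_hom K D (Alg Y)"
      by (rule linear_hom_compose[OF triass_homD(1)[OF \<psi>] _ module_axioms])
    have "the_elem (?g ` (I +> x)) = avg Y (\<psi> x)" if "x \<in> carrier D" for x
      using coset_lift[OF Y.A.module_axioms g _ that] vanish[OF \<psi>] that
      by (simp add: compose_def)
    then have "((\<lambda>U\<in>carrier Q. the_elem (?g ` U)), \<psi>) \<in> ravg_hom K QR Y"
      unfolding ravg_hom_quot_iff[OF Y] using \<psi> by (simp add: carrier_quot)
    then show ?thesis by (rule rev_image_eqI) simp
  qed
  then show "snd ` ravg_hom K QR Y = triass_hom K D (F_ob Y)"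
    by (intro equalityI subsetI) (auto simp only: ravg_hom_quot_iff[OF Y] snd_conv)
qed

end

section \<open>Functoriality of the quotient\<close>

locale triass_quotient_map = D: triass_quotient K D I + E: triass_quotient K E J
  for K :: "('k, 'm) ring_scheme" and D :: "('k, 'd) triass" and I
    and E :: "('k, 'e) triass" and J +
  fixes \<psi> :: "'d \<Rightarrow> 'e"
  assumes hom: "\<psi> \<in> triass_hom K D E" and maps_ideal: "i \<in> I \<Longrightarrow> \<psi> i \<in> J"
begin

lemma fst_quot_map_coset:
  assumes "x \<in> carrier D"
  shows "fst (quot_map D I E J \<psi>) (I +>\<^bsub>D\<^esub> x) = J +>\<^bsub>E\<^esub> \<psi> x"
proof -
  note lin = triass_homD(1)[OF hom]
  have "J +>\<^bsub>E\<^esub> \<psi> x' = J +>\<^bsub>E\<^esub> \<psi> x" if "x' \<in> I +>\<^bsub>D\<^esub> x" for x'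
  proof -
    note x' = D.coset_memD[OF assms that]
    have "\<psi> x' \<ominus>\<^bsub>E\<^esub> \<psi> x \<in> J"
      using maps_ideal[OF x'(3)] x'(1) assms
        linear_hom_group_hom(3)[OF D.module_axioms E.module_axioms lin] by simp
    then show ?thesis
      using linear_homD(2)[OF lin] x'(1) assms by (simp add: E.coset_eq_iff)
  qed
  then have "(\<Union>x'\<in>I +>\<^bsub>D\<^esub> x. J +>\<^bsub>E\<^esub> \<psi> x') = J +>\<^bsub>E\<^esub> \<psi> x"
    by (rule D.UN_coset[OF assms])
  then show ?thesis
    using assms by (auto simp: quot_map_def A_RCOSETS_def')
qed

lemma quot_map_hom: "quot_map D I E J \<psi> \<in> ravg_hom K (quot_ravg D I) (quot_ravg E J)"
proof -
  have closed: "\<psi> x \<in> carrier E" if "x \<in> carrier D" for x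
    using linear_homD(2)[OF triass_homD(1)[OF hom] that] .
  \<comment> \<open>Applying F to the quotient of \<open>E\<close> recovers the operations of
    \<open>E\<close>, since \<open>x\<cdot>q(y) = x \<stileturn> y\<close> and
    \<open>q(x)\<cdot>y = x \<turnstile> y\<close>. Thus the criterion
    \<open>ravg_hom_quot_iff\<close> applies to \<open>\<psi>\<close>.\<close>
  have "\<psi> \<in> triass_hom K D (F_ob (quot_ravg E J))"
    using hom by (auto simp: triass_hom_def linear_hom_def F_ob_sel E.quot_simps closed)
  moreover have "fst (quot_map D I E J \<psi>) \<in> extensional (carrier D.Q)"
    by (simp add: quot_map_def quot_alg_def)
  ultimately have "(fst (quot_map D I E J \<psi>), \<psi>) \<in> ravg_hom K (quot_ravg D I) (quot_ravg E J)"
    unfolding D.ravg_hom_quot_iff[OF E.relative_averaging_quot]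
    by (simp add: fst_quot_map_coset closed E.avg_quot)
  then show ?thesis
    by (simp add: quot_map_def)
qed

end

lemma triass_hom_id: "triassociative_algebra K D \<Longrightarrow> (\<lambda>x\<in>carrier D. x) \<in> triass_hom K D D"
proof -
  assume "triassociative_algebra K D"
  then interpret triassociative_algebra K D .
  show ?thesis by (auto simp: triass_hom_def linear_hom_def)
qed

lemma triass_hom_compose:
  assumes "triassociative_algebra K D" "f \<in> triass_hom K D E" "g \<in> triass_hom K E F"
  shows "compose (carrier D) g f \<in> triass_hom K D F"
proof -
  interpret triassociative_algebra K D by fact
  show ?thesis
    using linear_hom_compose[OF triass_homD(1)[OF assms(2)] triass_homD(1)[OF assms(3)] module_axioms]
      linear_homD(2)[OF triass_homD(1)[OF assms(2)]]
    by (auto simp: triass_hom_def[of K D F] compose_def triass_homD(2-)[OF assms(2)]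
        triass_homD(2-)[OF assms(3)])
qed

lemma (in triass_quotient) quot_map_id: "quot_map D I D I (\<lambda>x\<in>carrier D. x) = ravg_id QR"
proof -
  interpret m: triass_quotient_map K D I D I "\<lambda>x\<in>carrier D. x"
    by unfold_locales (auto intro: triass_hom_id triassociative_algebra_axioms)
  have "fst (quot_map D I D I (\<lambda>x\<in>carrier D. x)) = (\<lambda>U\<in>carrier Q. U)"
  proof (rule extensionalityI[of _ "carrier Q"])
    show "fst (quot_map D I D I (\<lambda>x\<in>carrier D. x)) \<in> extensional (carrier Q)"
      by (simp add: quot_map_def quot_alg_def)
  qed (auto simp: carrier_quot m.fst_quot_map_coset)
  then show ?thesis
    by (simp add: ravg_id_def quot_simps) (simp add: quot_map_def)
qed

text \<open>Both first components send the class of \<open>x\<close> to the class of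
  \<open>g (f x)\<close> and are \<open>undefined\<close> off the classes, so they agree as
  functions.\<close>

lemma quot_map_compose:
  assumes "triass_quotient_map K D I E J f" "triass_quotient_map K E J F L g"
  shows "quot_map D I F L (compose (carrier D) g f) =
    ravg_comp (quot_ravg D I) (quot_map E J F L g) (quot_map D I E J f)"
proof -
  interpret f: triass_quotient_map K D I E J f by fact
  interpret g: triass_quotient_map K E J F L g by fact
  interpret gf: triass_quotient_map K D I F L "compose (carrier D) g f"
    using triass_hom_compose[OF f.D.triassociative_algebra_axioms f.hom g.hom]
    by unfold_locales (auto simp: compose_def f.maps_ideal g.maps_ideal)
  have "fst (quot_map D I F L (compose (carrier D) g f)) =
      compose (carrier f.D.Q) (fst (quot_map E J F L g)) (fst (quot_map D I E J f))"
  proof (rule extensionalityI[of _ "carrier f.D.Q"])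
    show "fst (quot_map D I F L (compose (carrier D) g f)) \<in> extensional (carrier f.D.Q)"
      by (simp add: quot_map_def quot_alg_def)
    show "compose (carrier f.D.Q) (fst (quot_map E J F L g)) (fst (quot_map D I E J f))
        \<in> extensional (carrier f.D.Q)"
      by simp
    fix U assume "U \<in> carrier f.D.Q"
    then obtain x where "x \<in> carrier D" "U = I +>\<^bsub>D\<^esub> x" by (auto simp: f.D.carrier_quot)
    then show "fst (quot_map D I F L (compose (carrier D) g f)) U =
        compose (carrier f.D.Q) (fst (quot_map E J F L g)) (fst (quot_map D I E J f)) U"
      using linear_homD(2)[OF triass_homD(1)[OF f.hom]] gf.fst_quot_map_coset[of x]
      by (simp add: compose_def f.D.carrier_quot f.fst_quot_map_coset g.fst_quot_map_coset)
  qed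
  then show ?thesis
    by (simp add: ravg_comp_def f.D.quot_simps) (simp add: quot_map_def)
qed

section \<open>The two ideals as instances\<close>

lemma triass_quotient_ass_ideal:
  assumes "triassociative_algebra K D"
  shows "triass_quotient K D (ass_ideal K D)"
proof -
  interpret triassociative_algebra K D by fact
  have "ass_ideal K D \<subseteq> {i \<in> carrier D. \<forall>y\<in>carrier D. i \<turnstile>\<^bsub>D\<^esub> y = \<zero>\<^bsub>D\<^esub> \<and> y \<stileturn>\<^bsub>D\<^esub> i = \<zero>\<^bsub>D\<^esub>}"
    by (rule ass_ideal_minimal[OF annihilator_ideal])
      (simp add: triass_assoc minus_eq_zero_iff)
  then show ?thesis
    by unfold_locales (auto simp: ass_ideal_ideal ass_ideal_gen)
qed

lemma triass_quotient_avg_ideal: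
  assumes "triassociative_algebra K D"
  shows "triass_quotient K D (avg_ideal K D)"
proof -
  interpret triassociative_algebra K D by fact
  have "avg_ideal K D \<subseteq> {i \<in> carrier D. \<forall>y\<in>carrier D. i \<turnstile>\<^bsub>D\<^esub> y = \<zero>\<^bsub>D\<^esub> \<and> y \<stileturn>\<^bsub>D\<^esub> i = \<zero>\<^bsub>D\<^esub>}"
    by (rule avg_ideal_minimal[OF annihilator_ideal])
      (simp_all add: triass_assoc minus_eq_zero_iff)
  then show ?thesis
    by unfold_locales (auto simp: avg_ideal_ideal avg_ideal_gen)
qed

lemma (in triassociative_algebra) ass_ideal_subset_avg_ideal: "ass_ideal K D \<subseteq> avg_ideal K D"
  by (rule ass_ideal_minimal[OF avg_ideal_ideal avg_ideal_gen(1)])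

text \<open>A morphism sends generators to generators, so the preimage of the ideal of
  \<open>E\<close> is an ideal of \<open>D\<close> containing all generators of the ideal of
  \<open>D\<close>.\<close>

lemma quotient_map_ass_ideal:
  assumes "triassociative_algebra K D" "triassociative_algebra K E" "\<psi> \<in> triass_hom K D E"
  shows "triass_quotient_map K D (ass_ideal K D) E (ass_ideal K E) \<psi>"
proof -
  interpret D: triassociative_algebra K D by fact
  interpret E: triassociative_algebra K E by fact
  note lin = triass_homD(1)[OF assms(3)]
  have "ass_ideal K D \<subseteq> {x \<in> carrier D. \<psi> x \<in> ass_ideal K E}"
    by (rule D.ass_ideal_minimal[OF triass_ideal_vimage[OF assms E.ass_ideal_ideal]])
      (simp add: linear_homD(2)[OF lin] triass_homD(2-)[OF assms(3)] E.ass_ideal_gen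
        linear_hom_group_hom(3)[OF D.module_axioms E.module_axioms lin])
  then show ?thesis
    using assms
    by (intro triass_quotient_map.intro triass_quotient_map_axioms.intro triass_quotient_ass_ideal)
      auto
qed

lemma quotient_map_avg_ideal:
  assumes "triassociative_algebra K D" "triassociative_algebra K E" "\<psi> \<in> triass_hom K D E"
  shows "triass_quotient_map K D (avg_ideal K D) E (avg_ideal K E) \<psi>"
proof -
  interpret D: triassociative_algebra K D by fact
  interpret E: triassociative_algebra K E by fact
  note lin = triass_homD(1)[OF assms(3)]
  have "avg_ideal K D \<subseteq> {x \<in> carrier D. \<psi> x \<in> avg_ideal K E}"
    by (rule D.avg_ideal_minimal[OF triass_ideal_vimage[OF assms E.avg_ideal_ideal]])
      (simp_all add: linear_homD(2)[OF lin] triass_homD(2-)[OF assms(3)] E.avg_ideal_gen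
        linear_hom_group_hom(3)[OF D.module_axioms E.module_axioms lin])
  then show ?thesis
    using assms
    by (intro triass_quotient_map.intro triass_quotient_map_axioms.intro triass_quotient_avg_ideal)
      auto
qed

section \<open>The functors and the natural bijections\<close>

theorem proposition5p5:
  fixes K :: "('k, 'm) ring_scheme"
    and D :: "('k, 'd) triass" and D' :: "('k, 'd1) triass" and D'' :: "('k, 'd2) triass"
    and X :: "('k, 'a, 'b) ravg" and X' :: "('k, 'a1, 'b1) ravg" and X'' :: "('k, 'a2, 'b2) ravg"
  assumes "field K" and "char_zero K"
    and "triassociative_algebra K D" and "triassociative_algebra K D'" and "triassociative_algebra K D''"
    and "relative_averaging_algebra_1 K X" and "relative_averaging_algebra_1 K X'"
    and "relative_averaging_algebra_1 K X''"
  shows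
    \<comment> \<open>the functor F\<close>
    "(triassociative_algebra K (F_ob X) \<and>
      (\<forall>h\<in>ravg_hom K X X'. F_map h \<in> triass_hom K (F_ob X) (F_ob X')) \<and>
      F_map (ravg_id X) = (\<lambda>x\<in>carrier (F_ob X). x) \<and>
      (\<forall>h\<in>ravg_hom K X X'. \<forall>h'\<in>ravg_hom K X' X''.
         F_map (ravg_comp X h' h) = compose (carrier (F_ob X)) (F_map h') (F_map h))) \<and>
    \<comment> \<open>the functor G\<close>
     (relative_averaging_algebra K (G_ob K D) \<and>
      (relative_averaging_algebra_1 K (G_ob K D) \<longleftrightarrow>
         (\<forall>x\<in>carrier D. \<forall>y\<in>carrier D. x \<stileturn>\<^bsub>D\<^esub> y \<ominus>\<^bsub>D\<^esub> x \<^bold>\<bottom>\<^bsub>D\<^esub> y \<in> ass_ideal K D)) \<and>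
      (\<forall>\<psi>\<in>triass_hom K D D'. G_map K D D' \<psi> \<in> ravg_hom K (G_ob K D) (G_ob K D')) \<and>
      G_map K D D (\<lambda>x\<in>carrier D. x) = ravg_id (G_ob K D) \<and>
      (\<forall>\<psi>\<in>triass_hom K D D'. \<forall>\<psi>'\<in>triass_hom K D' D''.
         G_map K D D'' (compose (carrier D) \<psi>' \<psi>) =
         ravg_comp (G_ob K D) (G_map K D' D'' \<psi>') (G_map K D D' \<psi>))) \<and>
    \<comment> \<open>the bijection, natural in D and X\<close>
     (bij_betw snd (ravg_hom K (G_ob K D) X) (triass_hom K D (F_ob X)) \<and>
      (\<forall>\<psi>\<in>triass_hom K D' D. \<forall>g\<in>ravg_hom K (G_ob K D) X. \<forall>h\<in>ravg_hom K X X'.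
         snd (ravg_comp (G_ob K D') (ravg_comp (G_ob K D) h g) (G_map K D' D \<psi>)) =
         compose (carrier D') (compose (carrier D) (F_map h) (snd g)) \<psi>)) \<and>
    \<comment> \<open>the same for the enlarged ideal, with values in weight 1\<close>
     (relative_averaging_algebra_1 K (G1_ob K D) \<and>
      (\<forall>\<psi>\<in>triass_hom K D D'. G1_map K D D' \<psi> \<in> ravg_hom K (G1_ob K D) (G1_ob K D')) \<and>
      G1_map K D D (\<lambda>x\<in>carrier D. x) = ravg_id (G1_ob K D) \<and>
      (\<forall>\<psi>\<in>triass_hom K D D'. \<forall>\<psi>'\<in>triass_hom K D' D''.
         G1_map K D D'' (compose (carrier D) \<psi>' \<psi>) =
         ravg_comp (G1_ob K D) (G1_map K D' D'' \<psi>') (G1_map K D D' \<psi>)) \<and>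
      bij_betw snd (ravg_hom K (G1_ob K D) X) (triass_hom K D (F_ob X)) \<and>
      (\<forall>\<psi>\<in>triass_hom K D' D. \<forall>g\<in>ravg_hom K (G1_ob K D) X. \<forall>h\<in>ravg_hom K X X'.
         snd (ravg_comp (G1_ob K D') (ravg_comp (G1_ob K D) h g) (G1_map K D' D \<psi>)) =
         compose (carrier D') (compose (carrier D) (F_map h) (snd g)) \<psi>))"
proof -
  note D = assms(3) and D' = assms(4) and D'' = assms(5)
  interpret D: triassociative_algebra K D by fact
  interpret X: relative_averaging_algebra_1 K X by fact
  interpret G: triass_quotient K D "ass_ideal K D" by (rule triass_quotient_ass_ideal[OF D])
  interpret G1: triass_quotient K D "avg_ideal K D" by (rule triass_quotient_avg_ideal[OF D])
  have "F_map h \<in> triass_hom K (F_ob X) (F_ob X')" if "h \<in> ravg_hom K X X'" for h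
    using that X.relative_averaging_algebra_axioms by (rule F_map_hom)
  moreover have "F_map (ravg_id X) = (\<lambda>x\<in>carrier (F_ob X). x)"
    by (simp add: F_map_def ravg_id_def F_ob_sel)
  moreover have "F_map (ravg_comp X h' h) = compose (carrier (F_ob X)) (F_map h') (F_map h)"
    for h :: "('a \<Rightarrow> 'a1) \<times> ('b \<Rightarrow> 'b1)" and h' :: "('a1 \<Rightarrow> 'a2) \<times> ('b1 \<Rightarrow> 'b2)"
    by (simp add: F_map_def ravg_comp_def F_ob_sel)
  moreover have "relative_averaging_algebra K (G_ob K D)"
    unfolding G_ob_def by (rule G.relative_averaging_quot)
  moreover have "relative_averaging_algebra_1 K (G_ob K D) \<longleftrightarrow>
      (\<forall>x\<in>carrier D. \<forall>y\<in>carrier D. x \<stileturn>\<^bsub>D\<^esub> y \<ominus>\<^bsub>D\<^esub> x \<^bold>\<bottom>\<^bsub>D\<^esub> y \<in> ass_ideal K D)"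
    unfolding G_ob_def by (rule G.relative_averaging_1_quot_iff)
  \<comment> \<open>The generators added in \<open>avg_ideal\<close> are exactly the elements that
    the weight 1 criterion asks for.\<close>
  moreover have "relative_averaging_algebra_1 K (G1_ob K D)"
    unfolding G1_ob_def G1.relative_averaging_1_quot_iff by (simp add: D.avg_ideal_gen)
  moreover have "G_map K D D' \<psi> \<in> ravg_hom K (G_ob K D) (G_ob K D')"
    "G1_map K D D' \<psi> \<in> ravg_hom K (G1_ob K D) (G1_ob K D')" if "\<psi> \<in> triass_hom K D D'" for \<psi>
    unfolding G_map_def G_ob_def G1_map_def G1_ob_def
    by (intro triass_quotient_map.quot_map_hom quotient_map_ass_ideal quotient_map_avg_ideal
        D D' that)+
  moreover have "G_map K D D (\<lambda>x\<in>carrier D. x) = ravg_id (G_ob K D)"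
    "G1_map K D D (\<lambda>x\<in>carrier D. x) = ravg_id (G1_ob K D)"
    unfolding G_map_def G_ob_def G1_map_def G1_ob_def
    by (rule G.quot_map_id G1.quot_map_id)+
  moreover have "G_map K D D'' (compose (carrier D) \<psi>' \<psi>) =
      ravg_comp (G_ob K D) (G_map K D' D'' \<psi>') (G_map K D D' \<psi>)"
    "G1_map K D D'' (compose (carrier D) \<psi>' \<psi>) =
      ravg_comp (G1_ob K D) (G1_map K D' D'' \<psi>') (G1_map K D D' \<psi>)"
    if "\<psi> \<in> triass_hom K D D'" "\<psi>' \<in> triass_hom K D' D''" for \<psi> \<psi>'
    unfolding G_map_def G_ob_def G1_map_def G1_ob_def
    by (rule quot_map_compose[OF quotient_map_ass_ideal[OF D D' that(1)]
          quotient_map_ass_ideal[OF D' D'' that(2)]]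
        quot_map_compose[OF quotient_map_avg_ideal[OF D D' that(1)]
          quotient_map_avg_ideal[OF D' D'' that(2)]])+
  \<comment> \<open>\<open>P\<close> after a morphism to \<open>F_ob X\<close> kills
    \<open>avg_ideal K D\<close>, hence also the smaller \<open>ass_ideal K D\<close>; so the
    bijection holds even where \<open>G_ob K D\<close> fails weight 1.\<close>
  moreover have "bij_betw snd (ravg_hom K (G_ob K D) X) (triass_hom K D (F_ob X))"
    unfolding G_ob_def using D.ass_ideal_subset_avg_ideal
    by (intro G.bij_betw_ravg_hom_triass_hom X.relative_averaging_algebra_axioms
        X.avg_vanishes[OF D]) auto
  moreover have "bij_betw snd (ravg_hom K (G1_ob K D) X) (triass_hom K D (F_ob X))"
    unfolding G1_ob_def
    by (intro G1.bij_betw_ravg_hom_triass_hom X.relative_averaging_algebra_axioms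
        X.avg_vanishes[OF D])
  \<comment> \<open>The bijection is \<open>snd\<close>, and composites of pairs are formed
    componentwise, so naturality comes out by unfolding.\<close>
  moreover have "snd (ravg_comp (G_ob K D') (ravg_comp (G_ob K D) h g) (G_map K D' D \<psi>)) =
      compose (carrier D') (compose (carrier D) (F_map h) (snd g)) \<psi>"
    "snd (ravg_comp (G1_ob K D') (ravg_comp (G1_ob K D) h g) (G1_map K D' D \<psi>)) =
      compose (carrier D') (compose (carrier D) (F_map h) (snd g)) \<psi>"
    for \<psi> :: "'d1 \<Rightarrow> 'd" and g :: "('d set \<Rightarrow> 'a) \<times> ('d \<Rightarrow> 'b)"
      and h :: "('a \<Rightarrow> 'a1) \<times> ('b \<Rightarrow> 'b1)"
    by (simp_all add: ravg_comp_def F_map_def G_ob_def G1_ob_def G_map_def G1_map_def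
        quot_ravg_def perp_alg_def quot_map_def)
  ultimately show ?thesis
    using X.triassociative_F_ob by (intro conjI ballI) simp_all
qed

end
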